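(* Let $\alpha>0$ and $\beta\in(0,1)$ and consider the family of differential equations \[ x'=y,\qquad y'=z^2\sin x\cos x-\sin x-\varepsilon y,\qquad z'=\alpha(\cos x-\beta), \] with equilibrium point $P_0=(\arccos\beta,\,0,\,\sqrt{1/\beta})$. The first Lyapunov coefficient at $P_0$ on the Hopf surface $\varepsilon=\varepsilon_c=2\alpha\beta^{3/2}$ is given by \[ l_1(\beta,\alpha,\varepsilon_c)=-\frac{\alpha\beta^2\sqrt{1-\beta^2}\,\left(3+(\alpha^2-5)\beta^2+\alpha^4\beta^6\right)}{2\left(1-\beta^2+\alpha^2\beta^4\right)\left(1-\beta^2+4\alpha^2\beta^4\right)} . \]
   Context: The state is $(x,y,z)\in(0,\pi/2)\times\mathbb R\times[0,\infty)$. Put $\omega_0=\sqrt{(1-\beta^2)/\beta}$. First Lyapunov coefficient: let $F(\mathbf x)=A\mathbf x+\frac12B(\mathbf x,\mathbf x)+\frac16C(\mathbf x,\mathbf x,\mathbf x)+O(\|\mathbf x\|^4)$ be the Taylor expansion of the vector field (at $\varepsilon=\varepsilon_c$) in coordinates translated so that $P_0$ is the origin, where $B_i(\mathbf x,\mathbf y)=\sum_{j,k=1}^3\frac{\partial^2F_i}{\partial\xi_j\partial\xi_k}(0)\,x_jy_k$ and $C_i(\mathbf x,\mathbf y,\mathbf z)=\sum_{j,k,r=1}^3\frac{\partial^3F_i}{\partial\xi_j\partial\xi_k\partial\xi_r}(0)\,x_jy_kz_r$. The matrix $A$ has eigenvalues $-\varepsilon_c,\ \pm i\omega_0$. Let $p,q\in\mathbb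 C^3$ satisfy $Aq=i\omega_0q$, $A^{\top}p=-i\omega_0p$, $\langle p,q\rangle=\sum_i\bar p_iq_i=1$, with the normalization \[ q=\left(-i,\ \omega_0,\ \frac{\varepsilon_c}{2\beta}\right),\qquad p=\left(-\frac i2,\ \frac{\omega_0-i\varepsilon_c}{2(\omega_0^2+\varepsilon_c^2)},\ \frac{\beta(\varepsilon_c+i\omega_0)}{\omega_0^2+\varepsilon_c^2}\right). \] Then \[ l_1=\frac1{2\omega_0}\,\mathrm{Re}\,\Big\langle p,\ C(q,q,\bar q)+B\big(\bar q,(2i\omega_0I_3-A)^{-1}B(q,q)\big)-2B\big(q,A^{-1}B(q,\bar q)\big)\Big\rangle , \] where $I_3$ is the $3\times3$ identity matrix. *)

theory Defs
  imports "HOL-Analysis.Analysis"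
begin

section \<open>The first Lyapunov coefficient of a vector field on three-space\<close>

definition partial_deriv :: "3 \<Rightarrow> (real^3 \<Rightarrow> real) \<Rightarrow> real^3 \<Rightarrow> real" where
  "partial_deriv j f x = deriv (\<lambda>t. f (x + t *\<^sub>R axis j 1)) 0"

text \<open>The Taylor coefficients at the origin. The forms \<open>B\<close> and \<open>C\<close> have real coefficients but are
  taken on complex vectors, as they are evaluated at complex eigenvectors.\<close>

definition taylor_A :: "(real^3 \<Rightarrow> real^3) \<Rightarrow> complex^3^3" where
  "taylor_A F = map_matrix complex_of_real (jacobian F (at 0))"

definition taylor_B :: "(real^3 \<Rightarrow> real^3) \<Rightarrow> complex^3 \<Rightarrow> complex^3 \<Rightarrow> complex^3" where
  "taylor_B F x y = (\<chi> i. \<Sum>j\<in>UNIV. \<Sum>k\<in>UNIV.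
     of_real (partial_deriv j (partial_deriv k (\<lambda>\<xi>. F \<xi> $ i)) 0) * x $ j * y $ k)"

definition taylor_C ::
  "(real^3 \<Rightarrow> real^3) \<Rightarrow> complex^3 \<Rightarrow> complex^3 \<Rightarrow> complex^3 \<Rightarrow> complex^3" where
  "taylor_C F x y z = (\<chi> i. \<Sum>j\<in>UNIV. \<Sum>k\<in>UNIV. \<Sum>r\<in>UNIV.
     of_real (partial_deriv j (partial_deriv k (partial_deriv r (\<lambda>\<xi>. F \<xi> $ i))) 0)
       * x $ j * y $ k * z $ r)"

text \<open>The library's \<open>\<bullet>\<close> is real-valued on \<open>complex^3\<close>; the Hermitian product is needed here.\<close>

definition herm :: "complex^3 \<Rightarrow> complex^3 \<Rightarrow> complex" where
  "herm p q = (\<Sum>i\<in>UNIV. cnj (p $ i) * q $ i)"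

definition cnj_vec :: "complex^3 \<Rightarrow> complex^3" where
  "cnj_vec q = (\<chi> i. cnj (q $ i))"

text \<open>\<open>F\<close> is the vector field in coordinates in which the equilibrium is the origin. The value
  depends on the scaling of \<open>q\<close>, so the eigenvectors are arguments.\<close>

definition first_lyapunov_coeff ::
  "(real^3 \<Rightarrow> real^3) \<Rightarrow> real \<Rightarrow> complex^3 \<Rightarrow> complex^3 \<Rightarrow> real" where
  "first_lyapunov_coeff F \<omega> p q =
     (let A = taylor_A F; B = taylor_B F; C = taylor_C F; q' = cnj_vec q in
      1 / (2 * \<omega>) * Re (herm p
        (C q q q'
         + B q' (matrix_inv (mat (2 * \<i> * of_real \<omega>) - A) *v B q q)
         - 2 *s B q (matrix_inv A *v B q q'))))"


section \<open>The family of differential equations\<close>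

definition state_space :: "(real^3) set" where
  "state_space = {v. v $ 1 \<in> {0<..<pi/2} \<and> v $ 3 \<ge> 0}"

definition governor_field :: "real \<Rightarrow> real \<Rightarrow> real \<Rightarrow> real^3 \<Rightarrow> real^3" where
  "governor_field \<alpha> \<beta> \<epsilon> v = (let x = v $ 1; y = v $ 2; z = v $ 3 in
     vector [y, z\<^sup>2 * sin x * cos x - sin x - \<epsilon> * y, \<alpha> * (cos x - \<beta>)])"

definition P0 :: "real \<Rightarrow> real^3" where
  "P0 \<beta> = vector [arccos \<beta>, 0, sqrt (1 / \<beta>)]"

definition \<epsilon>\<^sub>c :: "real \<Rightarrow> real \<Rightarrow> real" where
  "\<epsilon>\<^sub>c \<alpha> \<beta> = 2 * \<alpha> * \<beta> powr (3/2)"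

definition \<omega>\<^sub>0 :: "real \<Rightarrow> real" where
  "\<omega>\<^sub>0 \<beta> = sqrt ((1 - \<beta>\<^sup>2) / \<beta>)"

definition hopf_q :: "real \<Rightarrow> real \<Rightarrow> complex^3" where
  "hopf_q \<alpha> \<beta> = vector [- \<i>, of_real (\<omega>\<^sub>0 \<beta>), of_real (\<epsilon>\<^sub>c \<alpha> \<beta> / (2 * \<beta>))]"

definition hopf_p :: "real \<Rightarrow> real \<Rightarrow> complex^3" where
  "hopf_p \<alpha> \<beta> = (let \<omega> = \<omega>\<^sub>0 \<beta>; \<epsilon> = \<epsilon>\<^sub>c \<alpha> \<beta> in
     vector [- \<i> / 2,
       (of_real \<omega> - \<i> * of_real \<epsilon>) / of_real (2 * (\<omega>\<^sup>2 + \<epsilon>\<^sup>2)),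
       of_real \<beta> * (of_real \<epsilon> + \<i> * of_real \<omega>) / of_real (\<omega>\<^sup>2 + \<epsilon>\<^sup>2)])"

text \<open>The facts below confirm that the data above are as intended: the two vectors are
  eigenvectors with the required normalization, and the two matrices that
  \<^const>\<open>first_lyapunov_coeff\<close> inverts are invertible, so that \<^const>\<open>matrix_inv\<close> is their inverse.\<close>

lemma P0_in_interior:
  assumes "0 < \<beta>" "\<beta> < 1"
  shows "P0 \<beta> $ 1 \<in> {0<..<pi/2}" "P0 \<beta> $ 3 > 0"
proof -
  have "arccos \<beta> < arccos 0" "arccos 1 < arccos \<beta>"
    using assms by (subst arccos_less_arccos; simp)+
  then show "P0 \<beta> $ 1 \<in> {0<..<pi/2}" "P0 \<beta> $ 3 > 0"
    using assms by (auto simp: P0_def vector_3)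
qed

lemma governor_jacobian:
  assumes "0 < \<beta>" "\<beta> < 1"
  defines "s \<equiv> sqrt (1 - \<beta>\<^sup>2)"
  shows "jacobian (\<lambda>\<xi>. governor_field \<alpha> \<beta> \<epsilon> (P0 \<beta> + \<xi>)) (at 0) =
    vector [vector [0, 1, 0],
            vector [- (1 - \<beta>\<^sup>2) / \<beta>, - \<epsilon>, 2 * s * sqrt \<beta>],
            vector [- \<alpha> * s, 0, 0]]" (is "_ = ?J")
proof -
  let ?F = "\<lambda>\<xi>. governor_field \<alpha> \<beta> \<epsilon> (P0 \<beta> + \<xi>)"
  have cs: "cos (arccos \<beta>) = \<beta>" "sin (arccos \<beta>) = s"
    using assms by (auto simp: s_def sin_arccos)
  have s2: "s * (s * u) = (1 - \<beta> * \<beta>) * u" for u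
    unfolding mult.assoc[symmetric]
    using assms by (auto simp: s_def power2_eq_square abs_square_le_1 mult_le_one)
  have z: "sqrt (1 / \<beta>) = sqrt \<beta> / \<beta>"
    using assms by (simp add: real_sqrt_divide real_div_sqrt field_simps)
  have "((\<lambda>\<xi>. ?F \<xi> $ i) has_derivative (\<lambda>h. (?J *v h) $ i)) (at 0)" for i
  proof -
    note D = bounded_linear.has_derivative[OF bounded_linear_vec_nth]
    have "((\<lambda>\<xi>. (P0 \<beta> + \<xi>) $ j) has_derivative (\<lambda>h. h $ j)) (at 0)" for j
      by (auto intro!: derivative_eq_intros D)
    note D' [derivative_intros] = this
    have v: "P0 \<beta> $ 1 = arccos \<beta>" "P0 \<beta> $ 2 = 0" "P0 \<beta> $ 3 = sqrt (1/\<beta>)"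
      by (simp_all add: P0_def)
    have "((\<lambda>\<xi>. ?F \<xi> $ 1) has_derivative (\<lambda>h. (?J *v h) $ 1)) (at 0)"
      unfolding governor_field_def Let_def vector_3 matrix_vector_mult_def
      by (rule derivative_eq_intros | simp add: sum_3 fun_eq_iff)+
    moreover have "((\<lambda>\<xi>. ?F \<xi> $ 2) has_derivative (\<lambda>h. (?J *v h) $ 2)) (at 0)"
      unfolding governor_field_def Let_def vector_3 matrix_vector_mult_def
      apply (rule derivative_eq_intros refl)+
      using assms(1,2) by (simp add: sum_3 fun_eq_iff v cs field_simps power2_eq_square s2 z)
    moreover have "((\<lambda>\<xi>. ?F \<xi> $ 3) has_derivative (\<lambda>h. (?J *v h) $ 3)) (at 0)"
      unfolding governor_field_def Let_def vector_3 matrix_vector_mult_def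
      by (rule derivative_eq_intros refl)+ (simp add: sum_3 fun_eq_iff v cs)
    ultimately show ?thesis using exhaust_3[of i] by auto
  qed
  then have "(?F has_derivative (\<lambda>h. ?J *v h)) (at 0)"
    by (subst has_derivative_componentwise_within)
       (auto simp: Basis_vec_def inner_axis)
  then have "frechet_derivative ?F (at 0) = (\<lambda>h. ?J *v h)"
    by (metis frechet_derivative_at)
  then show ?thesis by (simp add: jacobian_def matrix_of_matrix_vector_mul)
qed

lemma governor_taylor_A:
  fixes \<alpha> \<beta> :: real
  assumes "0 < \<beta>" "\<beta> < 1"
  defines "\<omega> \<equiv> \<omega>\<^sub>0 \<beta>" and "\<epsilon> \<equiv> \<epsilon>\<^sub>c \<alpha> \<beta>"
  shows "taylor_A (\<lambda>\<xi>. governor_field \<alpha> \<beta> \<epsilon> (P0 \<beta> + \<xi>)) =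
    vector [vector [0, 1, 0],
            vector [- of_real (\<omega>\<^sup>2), - of_real \<epsilon>, of_real (2 * \<beta> * \<omega>)],
            vector [- of_real (\<epsilon> * \<omega> / (2 * \<beta>)), 0, 0]]"
proof -
  have "0 < \<beta> * \<beta>" "\<beta> * \<beta> < 1"
    using assms mult_strict_mono[of \<beta> 1 \<beta> 1] by auto
  then have w: "\<omega>\<^sup>2 = (1 - \<beta>\<^sup>2) / \<beta>"
    using assms by (simp add: \<omega>\<^sub>0_def power2_eq_square)
  have s: "sqrt (1 - \<beta>\<^sup>2) = \<omega> * sqrt \<beta>"
    using assms by (simp add: \<omega>\<^sub>0_def real_sqrt_divide)
  have sb: "sqrt \<beta> * sqrt \<beta> = \<beta>" using assms by simp
  have e: "\<epsilon> = 2 * \<alpha> * \<beta> * sqrt \<beta>"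
    using assms powr_add[of \<beta> 1 "1/2"] by (simp add: \<epsilon>\<^sub>c_def powr_half_sqrt)
  have 1: "2 * sqrt (1 - \<beta>\<^sup>2) * sqrt \<beta> = 2 * \<beta> * \<omega>"
    using sb by (simp add: s)
  have 2: "\<alpha> * sqrt (1 - \<beta>\<^sup>2) = \<epsilon> * \<omega> / (2 * \<beta>)"
    using assms(1) by (simp add: s e)
  have 3: "- (1 - \<beta>\<^sup>2) / \<beta> = - (\<omega>\<^sup>2)" unfolding w by (rule minus_divide_left[symmetric])
  show ?thesis
    unfolding taylor_A_def governor_jacobian[OF assms(1,2)] 1 mult_minus_left 2 3
    by (simp add: vec_eq_iff forall_3 map_matrix_def)
qed

lemma hopf_eigenvectors:
  assumes "\<alpha> > 0" "0 < \<beta>" "\<beta> < 1"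
  defines "A \<equiv> taylor_A (\<lambda>\<xi>. governor_field \<alpha> \<beta> (\<epsilon>\<^sub>c \<alpha> \<beta>) (P0 \<beta> + \<xi>))"
  shows "A *v hopf_q \<alpha> \<beta> = (\<i> * \<omega>\<^sub>0 \<beta>) *s hopf_q \<alpha> \<beta>"
    and "transpose A *v hopf_p \<alpha> \<beta> = (- \<i> * \<omega>\<^sub>0 \<beta>) *s hopf_p \<alpha> \<beta>"
    and "herm (hopf_p \<alpha> \<beta>) (hopf_q \<alpha> \<beta>) = 1"
proof -
  define \<omega> \<epsilon> where d: "\<omega> = \<omega>\<^sub>0 \<beta>" "\<epsilon> = \<epsilon>\<^sub>c \<alpha> \<beta>"
  have pos: "\<epsilon> > 0" using assms by (simp add: d \<epsilon>\<^sub>c_def)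
  have nz: "complex_of_real (\<omega>\<^sup>2 + \<epsilon>\<^sup>2) \<noteq> 0"
    using pos by (metis of_real_eq_0_iff sum_power2_eq_zero_iff less_irrefl)
  have nz2: "\<omega>\<^sup>2 + \<epsilon>\<^sup>2 \<noteq> 0" using nz by (metis of_real_0)
  have nz3: "\<epsilon> * (\<epsilon> * 2) + \<omega> * (\<omega> * 2) \<noteq> 0"
    using nz2 by (auto simp: power2_eq_square add_nonneg_eq_0_iff)
  have nz': "\<beta> \<noteq> 0" using assms by simp
  note A = governor_taylor_A[OF assms(2,3), of \<alpha>, folded A_def d]
  show "A *v hopf_q \<alpha> \<beta> = (\<i> * \<omega>\<^sub>0 \<beta>) *s hopf_q \<alpha> \<beta>"
    using nz' unfolding A hopf_q_def d[symmetric]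
    by (simp add: vec_eq_iff forall_3 matrix_vector_mult_def sum_3 field_simps power2_eq_square)
  show "transpose A *v hopf_p \<alpha> \<beta> = (- \<i> * \<omega>\<^sub>0 \<beta>) *s hopf_p \<alpha> \<beta>"
    using nz nz' nz2 unfolding A hopf_p_def d[symmetric] Let_def
    by (simp add: vec_eq_iff forall_3 matrix_vector_mult_def sum_3 transpose_def
        divide_simps del: of_real_add of_real_power)
       (simp add: algebra_simps power2_eq_square, rule nz3)
  show "herm (hopf_p \<alpha> \<beta>) (hopf_q \<alpha> \<beta>) = 1"
    using nz nz' nz2 unfolding herm_def hopf_q_def hopf_p_def d[symmetric] Let_def
    by (simp add: sum_3 divide_simps del: of_real_add of_real_power, intro conjI impI)
       (use nz3 in \<open>auto simp: algebra_simps power2_eq_square\<close>)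
qed

lemma hopf_matrices_invertible:
  assumes "\<alpha> > 0" "0 < \<beta>" "\<beta> < 1"
  defines "A \<equiv> taylor_A (\<lambda>\<xi>. governor_field \<alpha> \<beta> (\<epsilon>\<^sub>c \<alpha> \<beta>) (P0 \<beta> + \<xi>))"
  shows "invertible A" and "invertible (mat (2 * \<i> * of_real (\<omega>\<^sub>0 \<beta>)) - A)"
proof -
  define \<omega> \<epsilon> where d: "\<omega> = \<omega>\<^sub>0 \<beta>" "\<epsilon> = \<epsilon>\<^sub>c \<alpha> \<beta>"
  have pos: "\<epsilon> > 0" "\<omega> > 0"
    using assms by (simp_all add: d \<epsilon>\<^sub>c_def \<omega>\<^sub>0_def power_less_one_iff)
  note A = governor_taylor_A[OF assms(2,3), of \<alpha>, folded A_def d]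
  have "det A = - of_real (\<epsilon> * \<omega>\<^sup>2)"
    using assms(2) unfolding A det_3 by (simp add: power2_eq_square)
  with pos show "invertible A"
    by (simp add: invertible_det_nz)
  have "det (mat (2 * \<i> * of_real \<omega>) - A) = - of_real (3 * \<omega>\<^sup>2) * (of_real \<epsilon> + 2 * \<i> * of_real \<omega>)"
    using assms(2) unfolding A det_3
    by (simp add: mat_def field_simps power2_eq_square)
  moreover have "of_real \<epsilon> + 2 * \<i> * of_real \<omega> \<noteq> 0"
    using pos by (simp add: complex_eq_iff)
  ultimately show "invertible (mat (2 * \<i> * of_real (\<omega>\<^sub>0 \<beta>)) - A)"
    using pos by (simp add: invertible_det_nz d)
qed

end

theory Submission
  imports Defs
begin

text \<open>
  The coefficient is an explicit expression in the derivatives of the field up to order three and in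
  the solutions of two linear systems, so the theorem is a computation; the point is to choose
  parameters and intermediate quantities in which it stays small.

  With \<open>r = sqrt \<beta>\<close> and \<open>s = sqrt (1 - \<beta>\<^sup>2)\<close> all data at the equilibrium are rational in \<open>\<alpha>\<close>, \<open>r\<close>, \<open>s\<close>:
  \<open>\<omega>\<^sub>0 = s / r\<close>, \<open>\<epsilon>\<^sub>c = 2 * \<alpha> * r ^ 3\<close>, the equilibrium has third coordinate \<open>1 / r\<close>, and
  \<open>q = (- \<i>, s / r, \<alpha> * r)\<close>. The only relation is \<open>s\<^sup>2 = 1 - r ^ 4\<close>. The derivatives of the field are
  found by rewriting within a family of functions closed under differentiation
  (\<open>partial_deriv_trig_poly\<close>).

  Write \<open>q'\<close> for the conjugate of \<open>q\<close>. The vectors \<open>A\<^sup>-\<^sup>1 B(q, q')\<close> and \<open>(2 \<i> \<omega>\<^sub>0 I - A)\<^sup>-\<^sup>1 B(q, q)\<close>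
  are given in closed form and checked by multiplication (\<open>zero_harmonic\<close>, \<open>second_harmonic\<close>). Up to
  constant factors they are the quadratic corrections of the oscillation at the frequencies \<open>0\<close> and
  \<open>2 * \<omega>\<^sub>0\<close>. The first is real and simple. The second depends on a single complex unknown \<open>w1\<close>,
  which solves a linear equation with coefficient \<open>s - \<i> * \<alpha> * r ^ 4\<close>, up to a real factor; the squared
  modulus \<open>E\<close> of that coefficient is one factor in the denominator of the result.

  The other factor is \<open>r\<^sup>2 * (\<omega>\<^sub>0\<^sup>2 + \<epsilon>\<^sub>c\<^sup>2)\<close> and comes from \<open>p\<close>. As the field has a linear first component
  and \<open>p\<^sub>3 = 2 \<i> \<beta> p\<^sub>2\<close>, pairing with \<open>p\<close> amounts to multiplying one complex number by
  \<open>\<omega>\<^sub>0 + \<i> * \<epsilon>\<^sub>c\<close> and a real factor, and so gives a real combination of the real and imaginary parts of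
  the cubic term (\<open>lyapunov_as_real_combination\<close>). These parts are affine in the real and imaginary
  parts of \<open>w1\<close>. Multiplying by \<open>3 * E\<close> removes the last denominators, and a polynomial identity in \<open>r\<close>
  and \<open>\<alpha>\<close> remains (\<open>real_combination_eq\<close>).\<close>

section \<open>Derivatives of the field\<close>

text \<open>
  As \<open>sin x * cos x = sin (2 * x) / 2\<close>, the components of the field belong to this family, which is
  closed under all partial derivatives: \<open>a\<close>, \<open>b\<close> are the amplitudes of the double angle and \<open>c\<close>, \<open>d\<close>
  those of the simple angle. The argument \<open>\<xi>\<close> is the displacement from \<open>P\<close>.\<close>

definition trig_poly ::
  "real^3 \<Rightarrow> nat \<Rightarrow> real \<Rightarrow> real \<Rightarrow> real \<Rightarrow> real \<Rightarrow> real \<Rightarrow> real \<Rightarrow> real^3 \<Rightarrow> real" where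
  "trig_poly P m a b c d e k \<xi> =
     (P $ 3 + \<xi> $ 3) ^ m * (a * sin (2 * (P $ 1 + \<xi> $ 1)) + b * cos (2 * (P $ 1 + \<xi> $ 1)))
     + c * sin (P $ 1 + \<xi> $ 1) + d * cos (P $ 1 + \<xi> $ 1) + e * (P $ 2 + \<xi> $ 2) + k"

lemma partial_deriv_eqI:
  assumes "\<And>x. ((\<lambda>t. f (x + t *\<^sub>R axis j 1)) has_field_derivative g x) (at 0)"
  shows "partial_deriv j f = g"
  unfolding partial_deriv_def using assms by (auto intro: DERIV_imp_deriv)

text \<open>These are identities between functions, so rewriting with them computes partial derivatives
  of every order.\<close>

lemma partial_deriv_trig_poly:
  "partial_deriv 1 (trig_poly P m a b c d e k) = trig_poly P m (- 2 * b) (2 * a) (- d) c 0 0"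
  "partial_deriv 2 (trig_poly P m a b c d e k) = trig_poly P 0 0 0 0 0 0 e"
  "partial_deriv 3 (trig_poly P m a b c d e k) =
     trig_poly P (m - 1) (real m * a) (real m * b) 0 0 0 0"
  by (rule partial_deriv_eqI,
      unfold trig_poly_def vector_add_component vector_scaleR_component real_scaleR_def,
      (rule derivative_eq_intros refl)+, simp add: axis_def algebra_simps)+

lemma governor_components:
  "(\<lambda>\<xi>. governor_field \<alpha> \<beta> \<epsilon> (P + \<xi>) $ 1) = trig_poly P 0 0 0 0 0 1 0"
  "(\<lambda>\<xi>. governor_field \<alpha> \<beta> \<epsilon> (P + \<xi>) $ 2) = trig_poly P 2 (1/2) 0 (-1) 0 (- \<epsilon>) 0"
  "(\<lambda>\<xi>. governor_field \<alpha> \<beta> \<epsilon> (P + \<xi>) $ 3) = trig_poly P 0 0 0 0 \<alpha> 0 (- \<alpha> * \<beta>)"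
  by (rule ext, simp add: governor_field_def trig_poly_def Let_def sin_double
      right_diff_distrib del: distrib_left_numeral)+

section \<open>The data at the equilibrium\<close>

lemma matrix_inv_mult_eq:
  fixes M :: "'a::field^'n^'n"
  assumes "invertible M" "M *v u = v"
  shows "matrix_inv M *v v = u"
proof -
  have "matrix_inv M ** M = mat 1"
    using assms(1) someI_ex[of "\<lambda>M'. M ** M' = mat 1 \<and> M' ** M = mat 1"]
    unfolding invertible_def matrix_inv_def by blast
  then show ?thesis
    using assms(2) by (metis matrix_vector_mul_assoc matrix_vector_mul_lid)
qed

text \<open>Here \<open>\<beta>\<close> is parametrized as \<open>r\<^sup>2\<close>, and \<open>s\<close> is \<open>sqrt (1 - \<beta>\<^sup>2)\<close>: this removes all roots from
  the computation.\<close>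

locale hopf_point =
  fixes \<alpha> r s :: real
  assumes \<alpha>_pos: "\<alpha> > 0" and r_pos: "r > 0" and s_pos: "s > 0" and s_sq: "s\<^sup>2 = 1 - r^4"
begin

abbreviation F :: "real^3 \<Rightarrow> real^3" where
  "F \<equiv> \<lambda>\<xi>. governor_field \<alpha> (r\<^sup>2) (\<epsilon>\<^sub>c \<alpha> (r\<^sup>2)) (P0 (r\<^sup>2) + \<xi>)"

abbreviation q :: "complex^3" where "q \<equiv> hopf_q \<alpha> (r\<^sup>2)"
abbreviation p :: "complex^3" where "p \<equiv> hopf_p \<alpha> (r\<^sup>2)"

lemma r_powers_less_1: "r\<^sup>2 < 1" "r ^ 4 < 1"
proof -
  have "s\<^sup>2 > 0" using s_pos by simp
  then show "r ^ 4 < 1" using s_sq by linarith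
  then have "r < 1" using r_pos power_less_one_iff[of r 4] by simp
  then show "r\<^sup>2 < 1" using r_pos by (simp add: power_less_one_iff)
qed

lemma parameters:
  "sqrt (1 - (r\<^sup>2)\<^sup>2) = s" "\<omega>\<^sub>0 (r\<^sup>2) = s / r" "\<epsilon>\<^sub>c \<alpha> (r\<^sup>2) = 2 * \<alpha> * r ^ 3"
proof -
  have "(r\<^sup>2)\<^sup>2 = r ^ 4" by (simp flip: power_mult)
  then show "sqrt (1 - (r\<^sup>2)\<^sup>2) = s"
    using s_pos s_sq by (metis less_imp_le real_sqrt_unique)
  then show "\<omega>\<^sub>0 (r\<^sup>2) = s / r"
    using r_pos by (simp add: \<omega>\<^sub>0_def real_sqrt_divide)
  have "(r\<^sup>2) powr (3/2) = (r powr 2) powr (3/2)" using r_pos by (simp add: powr_numeral)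
  also have "\<dots> = r ^ 3" unfolding powr_powr using r_pos by (simp add: powr_numeral)
  finally show "\<epsilon>\<^sub>c \<alpha> (r\<^sup>2) = 2 * \<alpha> * r ^ 3" by (simp add: \<epsilon>\<^sub>c_def)
qed

lemma trig_at_P0:
  "cos (P0 (r\<^sup>2) $ 1) = r\<^sup>2" "sin (P0 (r\<^sup>2) $ 1) = s"
  "cos (2 * P0 (r\<^sup>2) $ 1) = 2 * r ^ 4 - 1" "sin (2 * P0 (r\<^sup>2) $ 1) = 2 * r\<^sup>2 * s"
  "P0 (r\<^sup>2) $ 2 = 0" "P0 (r\<^sup>2) $ 3 = 1 / r"
proof -
  have r1: "-1 \<le> r\<^sup>2" "r\<^sup>2 \<le> 1" using r_powers_less_1 zero_le_power2[of r] by linarith+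
  show c: "cos (P0 (r\<^sup>2) $ 1) = r\<^sup>2" using r1 by (simp add: P0_def)
  show s: "sin (P0 (r\<^sup>2) $ 1) = s"
    using r1 parameters(1) by (simp add: P0_def sin_arccos)
  show "cos (2 * P0 (r\<^sup>2) $ 1) = 2 * r ^ 4 - 1"
    unfolding cos_double_cos c by (simp flip: power_mult)
  show "sin (2 * P0 (r\<^sup>2) $ 1) = 2 * r\<^sup>2 * s"
    unfolding sin_double s c by simp
  show "P0 (r\<^sup>2) $ 2 = 0" "P0 (r\<^sup>2) $ 3 = 1 / r"
    using r_pos by (simp_all add: P0_def real_sqrt_divide)
qed

lemma quadratic_part:
  "taylor_B F x y = vector [0,
     of_real (- 3 * s) * x $ 1 * y $ 1
       + of_real (2 * (2 * r ^ 4 - 1) / r) * (x $ 1 * y $ 3 + x $ 3 * y $ 1)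
       + of_real (2 * r\<^sup>2 * s) * x $ 3 * y $ 3,
     of_real (- \<alpha> * r\<^sup>2) * x $ 1 * y $ 1]"
  using r_pos
  by (simp only: vec_eq_iff forall_3 taylor_B_def vec_lambda_beta governor_components sum_3
      partial_deriv_trig_poly, simp add: trig_poly_def trig_at_P0)
     (simp add: field_simps eval_nat_numeral)

lemma cubic_part:
  "taylor_C F x y z = vector [0,
     of_real ((4 - 7 * r ^ 4) / r\<^sup>2) * x $ 1 * y $ 1 * z $ 1
       - of_real (8 * r * s) * (x $ 1 * y $ 1 * z $ 3 + x $ 1 * y $ 3 * z $ 1 + x $ 3 * y $ 1 * z $ 1)
       + of_real (2 * (2 * r ^ 4 - 1)) *
           (x $ 1 * y $ 3 * z $ 3 + x $ 3 * y $ 1 * z $ 3 + x $ 3 * y $ 3 * z $ 1),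
     of_real (\<alpha> * s) * x $ 1 * y $ 1 * z $ 1]"
  using r_pos
  by (simp only: vec_eq_iff forall_3 taylor_C_def vec_lambda_beta governor_components sum_3
      partial_deriv_trig_poly, simp add: trig_poly_def trig_at_P0)
     (simp add: field_simps eval_nat_numeral)

lemma linear_part:
  "taylor_A F = vector [vector [0, 1, 0],
     vector [- of_real (s\<^sup>2 / r\<^sup>2), - of_real (2 * \<alpha> * r ^ 3), of_real (2 * r * s)],
     vector [- of_real (\<alpha> * s), 0, 0]]"
  using r_powers_less_1 r_pos
  by (subst governor_taylor_A, simp, simp, unfold parameters)
     (simp add: power_divide vec_eq_iff forall_3 field_simps eval_nat_numeral)

lemma eigenvector_components:
  "q $ 1 = - \<i>" "q $ 2 = of_real (s / r)" "q $ 3 = of_real (\<alpha> * r)"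
  "cnj_vec q $ 1 = \<i>" "cnj_vec q $ 2 = of_real (s / r)" "cnj_vec q $ 3 = of_real (\<alpha> * r)"
  using r_pos unfolding hopf_q_def cnj_vec_def parameters
  by (simp_all add: power2_eq_square power3_eq_cube)

section \<open>The two quadratic corrections\<close>

text \<open>The index in \<open>h0\<close> and \<open>h2\<close> is the frequency of the correction in multiples of \<open>\<omega>\<^sub>0\<close>.\<close>

definition h0 :: "complex^3" where
  "h0 = vector [of_real (r\<^sup>2 / s), 0, of_real ((\<alpha>\<^sup>2 * r ^ 4 - 1) / r)]"

lemma zero_harmonic:
  "matrix_inv (taylor_A F) *v taylor_B F q (cnj_vec q) = h0"
proof (rule matrix_inv_mult_eq)
  show "invertible (taylor_A F)"
    using hopf_matrices_invertible(1)[of \<alpha> "r\<^sup>2"] \<alpha>_pos r_pos r_powers_less_1 by simp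
  show "taylor_A F *v h0 = taylor_B F q (cnj_vec q)"
    using r_pos s_pos unfolding linear_part quadratic_part eigenvector_components h0_def
    by (simp add: vec_eq_iff forall_3 matrix_vector_mult_def sum_3
        field_simps eval_nat_numeral)
qed

text \<open>The squared modulus of \<open>s - \<i> * \<alpha> * r ^ 4 = r / 2 * (2 * \<omega>\<^sub>0 - \<i> * \<epsilon>\<^sub>c)\<close>. It enters through the
  determinant of \<open>2 \<i> \<omega>\<^sub>0 I - A\<close>, which is \<open>- 3 * \<i> * \<omega>\<^sub>0\<^sup>2 * (2 * \<omega>\<^sub>0 - \<i> * \<epsilon>\<^sub>c)\<close>.\<close>

definition E :: real where "E = s\<^sup>2 + \<alpha>\<^sup>2 * r ^ 8"

lemma E_pos: "E > 0"
  unfolding E_def using s_pos by (simp add: add_pos_nonneg)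

text \<open>
  Eliminating the second and third unknown from \<open>(2 \<i> \<omega>\<^sub>0 I - A) w = B(q, q)\<close> leaves
  \<open>3 * s * (s - \<i> * \<alpha> * r ^ 4) * w1 = - r\<^sup>2 * c\<close> with
  \<open>c = s * (3 + 2 * \<alpha>\<^sup>2 * r ^ 4) - \<i> * \<alpha> * (9 * r ^ 4 - 4)\<close>. Multiplication by \<open>s + \<i> * \<alpha> * r ^ 4\<close> gives
  the formula for \<open>w1\<close>; the first and third row then give the other two components.\<close>

definition w1 :: complex where
  "w1 = Complex (- r\<^sup>2 * (3 - 3 * r ^ 4 - 2 * \<alpha>\<^sup>2 * r ^ 4 + 7 * \<alpha>\<^sup>2 * r ^ 8) / (3 * s * E))
     (- r\<^sup>2 * \<alpha> * (4 - 6 * r ^ 4 + 2 * \<alpha>\<^sup>2 * r ^ 8) / (3 * E))"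

definition w3 :: complex where
  "w3 = - \<i> * of_real (\<alpha> * r / (2 * s)) * (of_real (r\<^sup>2) - of_real s * w1)"

definition h2 :: "complex^3" where
  "h2 = vector [w1, 2 * \<i> * of_real (s / r) * w1, w3]"

abbreviation X :: real where "X \<equiv> Re w1"
abbreviation Y :: real where "Y \<equiv> Im w1"

lemma w3_parts: "Re w3 = - \<alpha> * r * Y / 2" "Im w3 = - \<alpha> * r * (r\<^sup>2 - s * X) / (2 * s)"
  using s_pos by (simp_all add: w3_def field_simps)

text \<open>The product \<open>s * X\<close> is kept together because then \<open>s\<close> occurs only in even powers in the
  polynomial identities to be checked, and \<open>s\<^sup>2 = 1 - r ^ 4\<close> eliminates it.\<close>

lemma harmonic_parts_times_E:
  "3 * E * (s * X) = - r\<^sup>2 * (3 - 3 * r ^ 4 - 2 * \<alpha>\<^sup>2 * r ^ 4 + 7 * \<alpha>\<^sup>2 * r ^ 8)"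
  "3 * E * Y = - r\<^sup>2 * \<alpha> * (4 - 6 * r ^ 4 + 2 * \<alpha>\<^sup>2 * r ^ 8)"
  using s_pos E_pos by (simp_all add: w1_def field_simps)

text \<open>The real part, divided by \<open>s\<close>, and the imaginary part of the equation from which \<open>w1\<close> is
  computed.\<close>

lemma harmonic_equations:
  "3 * (s * X + \<alpha> * r ^ 4 * Y) = - r\<^sup>2 * (3 + 2 * \<alpha>\<^sup>2 * r ^ 4)"
  "3 * (s\<^sup>2 * Y - \<alpha> * r ^ 4 * (s * X)) = r\<^sup>2 * \<alpha> * (9 * r ^ 4 - 4)"
proof -
  have E: "E = 1 - r ^ 4 + \<alpha>\<^sup>2 * r ^ 8" by (simp add: E_def s_sq)
  have "E * (3 * (s * X + \<alpha> * r ^ 4 * Y)) = 3 * E * (s * X) + \<alpha> * r ^ 4 * (3 * E * Y)"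
    by algebra
  also have "\<dots> = E * (- r\<^sup>2 * (3 + 2 * \<alpha>\<^sup>2 * r ^ 4))"
    unfolding harmonic_parts_times_E unfolding E by algebra
  finally show "3 * (s * X + \<alpha> * r ^ 4 * Y) = - r\<^sup>2 * (3 + 2 * \<alpha>\<^sup>2 * r ^ 4)"
    using E_pos by (metis less_irrefl mult_left_cancel)
  have "E * (3 * (s\<^sup>2 * Y - \<alpha> * r ^ 4 * (s * X)))
      = s\<^sup>2 * (3 * E * Y) - \<alpha> * r ^ 4 * (3 * E * (s * X))"
    by algebra
  also have "\<dots> = E * (r\<^sup>2 * \<alpha> * (9 * r ^ 4 - 4))"
    unfolding harmonic_parts_times_E unfolding E s_sq by algebra
  finally show "3 * (s\<^sup>2 * Y - \<alpha> * r ^ 4 * (s * X)) = r\<^sup>2 * \<alpha> * (9 * r ^ 4 - 4)"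
    using E_pos by (metis less_irrefl mult_left_cancel)
qed

lemma second_harmonic:
  "matrix_inv (mat (2 * \<i> * of_real (\<omega>\<^sub>0 (r\<^sup>2))) - taylor_A F) *v taylor_B F q q = h2"
proof (rule matrix_inv_mult_eq)
  show "invertible (mat (2 * \<i> * of_real (\<omega>\<^sub>0 (r\<^sup>2))) - taylor_A F)"
    using hopf_matrices_invertible(2)[of \<alpha> "r\<^sup>2"] \<alpha>_pos r_pos r_powers_less_1 by simp
  show "(mat (2 * \<i> * of_real (\<omega>\<^sub>0 (r\<^sup>2))) - taylor_A F) *v h2 = taylor_B F q q"
    unfolding linear_part quadratic_part eigenvector_components
    unfolding parameters vec_eq_iff forall_3
  proof (intro conjI)
    let ?R = "mat (2 * \<i> * of_real (s / r)) - vector [vector [0, 1, 0],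
     vector [- of_real (s\<^sup>2 / r\<^sup>2), - of_real (2 * \<alpha> * r ^ 3), of_real (2 * r * s)],
     vector [- of_real (\<alpha> * s), 0, 0]] :: complex^3^3"
    \<comment> \<open>Each row is compared with one entry of \<open>B(q, q)\<close>; \<open>a\<close> and \<open>b\<close> stand for the other two.\<close>
    show "(?R *v h2) $ 1 = (vector [0, a, b] :: complex^3) $ 1" for a b
      by (simp add: h2_def matrix_vector_mult_def sum_3 mat_def)
    show "(?R *v h2) $ 3 = (vector [a, b, of_real (- \<alpha> * r\<^sup>2) * - \<i> * - \<i>] :: complex^3) $ 3" for a b
      using r_pos s_pos
      by (simp add: h2_def matrix_vector_mult_def sum_3 mat_def w3_def field_simps
          eval_nat_numeral)
    show "(?R *v h2) $ 2 = (vector [a, of_real (- 3 * s) * - \<i> * - \<i> +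
      of_real (2 * (2 * r ^ 4 - 1) / r) * (- \<i> * of_real (\<alpha> * r) + of_real (\<alpha> * r) * - \<i>) +
      of_real (2 * r\<^sup>2 * s) * of_real (\<alpha> * r) * of_real (\<alpha> * r), b] :: complex^3) $ 2" for a b
    proof -
      \<comment> \<open>The left-hand sides below are the real and imaginary parts of the second row.\<close>
      have "s\<^sup>2 / r\<^sup>2 * X - 4 * s\<^sup>2 / r\<^sup>2 * X - 4 * \<alpha> * r\<^sup>2 * s * Y - 2 * r * s * Re w3
          = - s / r\<^sup>2 * (3 * (s * X + \<alpha> * r ^ 4 * Y))"
        unfolding w3_parts using r_pos by (simp add: field_simps eval_nat_numeral)
      also have "\<dots> = s * (3 + 2 * \<alpha>\<^sup>2 * r ^ 4)"
        unfolding harmonic_equations using r_pos by simp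
      finally have re: "s\<^sup>2 / r\<^sup>2 * X - 4 * s\<^sup>2 / r\<^sup>2 * X - 4 * \<alpha> * r\<^sup>2 * s * Y - 2 * r * s * Re w3
          = s * (3 + 2 * \<alpha>\<^sup>2 * r ^ 4)" .
      have "s\<^sup>2 / r\<^sup>2 * Y - 4 * s\<^sup>2 / r\<^sup>2 * Y + 4 * \<alpha> * r\<^sup>2 * s * X - 2 * r * s * Im w3
          = - 1 / r\<^sup>2 * (3 * (s\<^sup>2 * Y - \<alpha> * r ^ 4 * (s * X))) + \<alpha> * r ^ 4"
        unfolding w3_parts using r_pos s_pos by (simp add: field_simps eval_nat_numeral)
      also have "\<dots> = - \<alpha> * (8 * r ^ 4 - 4)"
        unfolding harmonic_equations using r_pos by (simp add: field_simps eval_nat_numeral)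
      finally have im: "s\<^sup>2 / r\<^sup>2 * Y - 4 * s\<^sup>2 / r\<^sup>2 * Y + 4 * \<alpha> * r\<^sup>2 * s * X - 2 * r * s * Im w3
          = - \<alpha> * (8 * r ^ 4 - 4)" .
      show ?thesis
        using r_pos re im
        by (simp add: h2_def matrix_vector_mult_def sum_3 mat_def complex_eq_iff)
           (simp add: field_simps eval_nat_numeral)
    qed
  qed
qed

section \<open>The coefficient\<close>

text \<open>The vector whose product with \<open>p\<close> enters the coefficient. Its first component vanishes because
  the first component of the field is linear.\<close>

definition cubic_term :: "complex^3" where
  "cubic_term = taylor_C F q q (cnj_vec q)
     + taylor_B F (cnj_vec q) h2
     - 2 *s taylor_B F q h0"

lemma cubic_term_parts:
  "cubic_term $ 1 = 0"
  "Re (cubic_term $ 2) = 3 * s * Y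
     + (2 * (2 * r ^ 4 - 1) / r) * (\<alpha> * r * X - Im w3) + 2 * \<alpha> * r ^ 3 * s * Re w3
     - 8 * \<alpha> * r\<^sup>2 * s - 4 * (2 * r ^ 4 - 1) * \<alpha> * r\<^sup>2 / s - 4 * \<alpha> * r\<^sup>2 * s * (\<alpha>\<^sup>2 * r ^ 4 - 1)"
  "Im (cubic_term $ 2) = - (4 - 7 * r ^ 4) / r\<^sup>2 - 2 * \<alpha>\<^sup>2 * r\<^sup>2 * (2 * r ^ 4 - 1) - 3 * s * X
     + (2 * (2 * r ^ 4 - 1) / r) * (Re w3 + \<alpha> * r * Y) + 2 * \<alpha> * r ^ 3 * s * Im w3
     - 6 * r\<^sup>2 + 4 * (2 * r ^ 4 - 1) * (\<alpha>\<^sup>2 * r ^ 4 - 1) / r\<^sup>2"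
  "Re (cubic_term $ 3) = \<alpha> * r\<^sup>2 * Y"
  "Im (cubic_term $ 3) = - \<alpha> * s - \<alpha> * r\<^sup>2 * X - 2 * \<alpha> * r ^ 4 / s"
  using r_pos s_pos unfolding cubic_term_def h0_def h2_def quadratic_part cubic_part
  by (simp_all add: eigenvector_components, simp_all add: field_simps eval_nat_numeral)

text \<open>On the critical surface \<open>p\<^sub>3 = 2 \<i> r\<^sup>2 p\<^sub>2\<close>, and the conjugate of \<open>p\<^sub>2\<close> is a positive multiple of
  \<open>s + 2 * \<i> * \<alpha> * r ^ 4\<close>. The bracket is the real part of the product of this number with
  \<open>V\<^sub>2 - 2 \<i> r\<^sup>2 V\<^sub>3\<close>, where \<open>V\<close> is the cubic term.\<close>

lemma lyapunov_as_real_combination: "first_lyapunov_coeff F (\<omega>\<^sub>0 (r\<^sup>2)) p q =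
  r\<^sup>2 / (4 * s * (s\<^sup>2 + 4 * \<alpha>\<^sup>2 * r ^ 8)) *
   (s * (Re (cubic_term $ 2) + 2 * r\<^sup>2 * Im (cubic_term $ 3))
      - 2 * \<alpha> * r ^ 4 * (Im (cubic_term $ 2) - 2 * r\<^sup>2 * Re (cubic_term $ 3)))"
proof -
  define D where "D = s\<^sup>2 + 4 * \<alpha>\<^sup>2 * r ^ 8"
  have D: "D > 0" unfolding D_def using s_pos by (simp add: add_pos_nonneg)
  have 1: "(s / r)\<^sup>2 + (2 * \<alpha> * r ^ 3)\<^sup>2 = D / r\<^sup>2"
    using r_pos by (simp add: D_def field_simps eval_nat_numeral)
  have "first_lyapunov_coeff F (\<omega>\<^sub>0 (r\<^sup>2)) p q = 1 / (2 * (s / r)) * Re (herm p cubic_term)"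
    unfolding first_lyapunov_coeff_def Let_def zero_harmonic second_harmonic cubic_term_def
    by (simp only: parameters(2))
  moreover have p_eq: "p = vector [- \<i> / 2, Complex (s * r / (2 * D)) (- \<alpha> * r ^ 5 / D),
      Complex (2 * \<alpha> * r ^ 7 / D) (s * r ^ 3 / D)]"
    using r_pos D unfolding hopf_p_def Let_def parameters 1
    by (simp add: vec_eq_iff forall_3 complex_eq_iff field_simps eval_nat_numeral)
  moreover have "1 / (2 * (s / r)) * Re (herm p cubic_term) = r\<^sup>2 / (4 * s * D) *
     (s * (Re (cubic_term $ 2) + 2 * r\<^sup>2 * Im (cubic_term $ 3))
      - 2 * \<alpha> * r ^ 4 * (Im (cubic_term $ 2) - 2 * r\<^sup>2 * Re (cubic_term $ 3)))"
    using r_pos D s_pos unfolding p_eq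
    by (simp add: herm_def sum_3 cubic_term_parts(1) field_simps eval_nat_numeral)
  ultimately show ?thesis unfolding D_def by simp
qed

lemma real_combination_eq:
  "s * (Re (cubic_term $ 2) + 2 * r\<^sup>2 * Im (cubic_term $ 3))
      - 2 * \<alpha> * r ^ 4 * (Im (cubic_term $ 2) - 2 * r\<^sup>2 * Re (cubic_term $ 3)) =
   - 2 * \<alpha> * r\<^sup>2 * s\<^sup>2 * (3 + (\<alpha>\<^sup>2 - 5) * r ^ 4 + \<alpha> ^ 4 * r ^ 12) / E" (is "?l = _")
proof -
  define X' where "X' = s * X"
  note w = harmonic_parts_times_E[folded X'_def]
  have E: "E = 1 - r ^ 4 + \<alpha>\<^sup>2 * r ^ 8" by (simp add: E_def s_sq)
  have "?l = \<alpha> * (2 * r ^ 4 - 1) * (r\<^sup>2 + X') - 2 * \<alpha> * r ^ 4 * X'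
      + (3 - \<alpha>\<^sup>2 * r ^ 4) * s\<^sup>2 * Y
      - \<alpha> * r\<^sup>2 * (8 * s\<^sup>2 + 4 * (2 * r ^ 4 - 1) + 4 * s\<^sup>2 * (\<alpha>\<^sup>2 * r ^ 4 - 1) + 2 * s\<^sup>2 + 4 * r ^ 4)
      - 2 * \<alpha> * r\<^sup>2 * (- (4 - 7 * r ^ 4) - 2 * \<alpha>\<^sup>2 * r ^ 4 * (2 * r ^ 4 - 1) - 3 * r\<^sup>2 * X'
        + r\<^sup>2 * (2 * r ^ 4 - 1) * \<alpha> * Y - \<alpha>\<^sup>2 * r ^ 6 * (r\<^sup>2 - X') - 6 * r ^ 4
        + 4 * (2 * r ^ 4 - 1) * (\<alpha>\<^sup>2 * r ^ 4 - 1) - 2 * \<alpha> * r ^ 6 * Y)"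
    using r_pos s_pos unfolding cubic_term_parts w3_parts X'_def
    by (simp add: field_simps eval_nat_numeral)
  \<comment> \<open>Collecting coefficients shows that the combination is affine in \<open>X'\<close> and \<open>Y\<close>, with coefficients
    that are polynomials in \<open>r\<close> and \<open>\<alpha>\<close>.\<close>
  also have "\<dots> = \<alpha> * r\<^sup>2 * (10 * r ^ 4 - 3 - 2 * \<alpha>\<^sup>2 * r ^ 8)
      + \<alpha> * (6 * r ^ 4 - 1 - 2 * \<alpha>\<^sup>2 * r ^ 8) * X'
      + ((3 - \<alpha>\<^sup>2 * r ^ 4) * (1 - r ^ 4) + 2 * \<alpha>\<^sup>2 * r ^ 4) * Y"
    unfolding s_sq by algebra
  finally have "3 * E * ?l = 3 * E * (\<alpha> * r\<^sup>2 * (10 * r ^ 4 - 3 - 2 * \<alpha>\<^sup>2 * r ^ 8))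
      + \<alpha> * (6 * r ^ 4 - 1 - 2 * \<alpha>\<^sup>2 * r ^ 8) * (3 * E * X')
      + ((3 - \<alpha>\<^sup>2 * r ^ 4) * (1 - r ^ 4) + 2 * \<alpha>\<^sup>2 * r ^ 4) * (3 * E * Y)"
    by algebra
  also have "\<dots> = 3 * (- 2 * \<alpha> * r\<^sup>2 * s\<^sup>2 * (3 + (\<alpha>\<^sup>2 - 5) * r ^ 4 + \<alpha> ^ 4 * r ^ 12))"
    unfolding w unfolding E s_sq by algebra
  finally show ?thesis using E_pos by (simp add: field_simps)
qed

lemma lyapunov_value: "first_lyapunov_coeff F (\<omega>\<^sub>0 (r\<^sup>2)) p q =
  - (\<alpha> * r^4 * s * (3 + (\<alpha>\<^sup>2 - 5) * r^4 + \<alpha>^4 * r^12))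
          / (2 * (s\<^sup>2 + \<alpha>\<^sup>2 * r^8) * (s\<^sup>2 + 4 * \<alpha>\<^sup>2 * r^8))"
proof -
  have "s\<^sup>2 + 4 * \<alpha>\<^sup>2 * r ^ 8 > 0" using s_pos by (simp add: add_pos_nonneg)
  with E_pos s_pos show ?thesis
    unfolding lyapunov_as_real_combination real_combination_eq E_def[symmetric]
    by (simp add: divide_simps eval_nat_numeral)
qed

end

theorem theorem3p5:
  fixes \<alpha> \<beta> \<epsilon> :: real
  assumes "\<alpha> > 0" and "\<beta> \<in> {0<..<1}"
  shows "P0 \<beta> \<in> state_space \<and>
    governor_field \<alpha> \<beta> \<epsilon> (P0 \<beta>) = 0 \<and>
    (\<epsilon> = \<epsilon>\<^sub>c \<alpha> \<beta> \<longrightarrow>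
      first_lyapunov_coeff (\<lambda>\<xi>. governor_field \<alpha> \<beta> \<epsilon> (P0 \<beta> + \<xi>))
          (\<omega>\<^sub>0 \<beta>) (hopf_p \<alpha> \<beta>) (hopf_q \<alpha> \<beta>) =
        - (\<alpha> * \<beta>\<^sup>2 * sqrt (1 - \<beta>\<^sup>2) * (3 + (\<alpha>\<^sup>2 - 5) * \<beta>\<^sup>2 + \<alpha>^4 * \<beta>^6))
          / (2 * (1 - \<beta>\<^sup>2 + \<alpha>\<^sup>2 * \<beta>^4) * (1 - \<beta>\<^sup>2 + 4 * \<alpha>\<^sup>2 * \<beta>^4)))"
proof (intro conjI impI)
  have \<beta>: "0 < \<beta>" "\<beta> < 1" using assms(2) by auto
  show "P0 \<beta> \<in> state_space"
    using P0_in_interior[OF \<beta>] by (simp add: state_space_def less_imp_le)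
  show "governor_field \<alpha> \<beta> \<epsilon> (P0 \<beta>) = 0"
    using \<beta> by (simp add: governor_field_def P0_def Let_def vec_eq_iff forall_3 field_simps)
  assume "\<epsilon> = \<epsilon>\<^sub>c \<alpha> \<beta>"
  define r s where "r = sqrt \<beta>" and "s = sqrt (1 - \<beta>\<^sup>2)"
  have b2: "\<beta>\<^sup>2 < 1" using \<beta> by (simp add: power_less_one_iff)
  have r: "\<beta> = r\<^sup>2" using \<beta> by (simp add: r_def)
  interpret hopf_point \<alpha> r s
  proof
    show "\<alpha> > 0" "r > 0" "s > 0" using assms(1) \<beta> b2 by (simp_all add: r_def s_def)
    show "s\<^sup>2 = 1 - r ^ 4" using b2 r by (simp add: s_def flip: power_mult)
  qed
  show "first_lyapunov_coeff (\<lambda>\<xi>. governor_field \<alpha> \<beta> \<epsilon> (P0 \<beta> + \<xi>))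
          (\<omega>\<^sub>0 \<beta>) (hopf_p \<alpha> \<beta>) (hopf_q \<alpha> \<beta>) =
        - (\<alpha> * \<beta>\<^sup>2 * sqrt (1 - \<beta>\<^sup>2) * (3 + (\<alpha>\<^sup>2 - 5) * \<beta>\<^sup>2 + \<alpha>^4 * \<beta>^6))
          / (2 * (1 - \<beta>\<^sup>2 + \<alpha>\<^sup>2 * \<beta>^4) * (1 - \<beta>\<^sup>2 + 4 * \<alpha>\<^sup>2 * \<beta>^4))"
    using lyapunov_value s_sq parameters(1) unfolding r \<open>\<epsilon> = _\<close> by (simp flip: power_mult)
qed

end
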